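(* Let $\alpha>0$, $\beta>0$, $p\in[0,1]$, and let $X$ be a random variable having the $\mathrm{RTUOMG}(\alpha,\beta,p)$ distribution. Then the quantile function $Q$ of $X$ (that is, for $u\in(0,1)$, $Q(u)$ is the solution $x$ of $F_X(x;\alpha,\beta,p)=u$) is $$Q(u)= \left[\frac{e^{\frac{-1}{\alpha}\left\{ W_{-1}\left(\frac{u-1}{pe^{1/p}}\right)+\frac{1}{p}\right\}}-1}{e^{\frac{-1}{\alpha}\left\{ W_{-1}\left(\frac{u-1}{pe^{1/p}}\right)+\frac{1}{p}\right\}}+1}\right]^{\frac{1}{\beta}},\qquad 0<u<1.$$
   Context: For $\alpha,\beta>0$ and $0<x<1$ write $$\omega_{1}^{(-2\alpha,\beta)}(x)=\left(\frac{1+x^\beta}{1-x^\beta}\right)^{-\alpha}.$$ A random variable $X$ has the record-based transmuted unit omega distribution $\mathrm{RTUOMG}(\alpha,\beta,p)$, with $\alpha>0$, $\beta>0$, $p\in[0,1]$, if it is supported on $(0,1)$ and its distribution function is $$F_{X}(x;\alpha,\beta,p)=1- \omega_{1}^{(-2\alpha,\beta)}(x)+p\,\omega_{1}^{(-2\alpha,\beta)}(x)\log \left(\omega_{1}^{(-2\alpha,\beta)}(x)\right),\qquad 0<x<1.$$ The Lambert W function is defined by $W(\xi)e^{W(\xi)}=\xi$; $W_{-1}$ denotes its negative real branch: for $\xi\in[-1/e,0)$, $W_{-1}(\xi)$ is the unique real number $w\le -1$ with $we^{w}=\xi$.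
   Formalization: For p = 0 the printed formula divides by p and is undefined; there the formal statement asserts instead that Q(u) exists uniquely and equals the limit of the formula as p tends to 0 from the right. *)

theory Defs
  imports "HOL-Probability.Probability"
begin

definition omega1 :: "real \<Rightarrow> real \<Rightarrow> real \<Rightarrow> real" where
  "omega1 \<alpha> \<beta> x = ((1 + x powr \<beta>) / (1 - x powr \<beta>)) powr (- \<alpha>)"

definition rtuomg_cdf :: "real \<Rightarrow> real \<Rightarrow> real \<Rightarrow> real \<Rightarrow> real" where
  "rtuomg_cdf \<alpha> \<beta> p x = 1 - omega1 \<alpha> \<beta> x + p * omega1 \<alpha> \<beta> x * ln (omega1 \<alpha> \<beta> x)"

definition has_rtuomg_distribution ::
  "'a measure \<Rightarrow> ('a \<Rightarrow> real) \<Rightarrow> real \<Rightarrow> real \<Rightarrow> real \<Rightarrow> bool" where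
  "has_rtuomg_distribution M X \<alpha> \<beta> p \<longleftrightarrow>
     X \<in> borel_measurable M \<and>
     (AE \<omega> in M. 0 < X \<omega> \<and> X \<omega> < 1) \<and>
     (\<forall>x. 0 < x \<and> x < 1 \<longrightarrow> cdf (distr M borel X) x = rtuomg_cdf \<alpha> \<beta> p x)"

text \<open>
  The equation is solved over all reals, with the actual distribution function of the measure;
  the value is only meaningful where the solution exists and is unique.
\<close>
definition quantile :: "real measure \<Rightarrow> real \<Rightarrow> real" where
  "quantile D u = (THE x. cdf D x = u)"

text \<open>The branch \<open>W\<^sub>-\<^sub>1\<close> of the Lambert W function, meaningful for \<open>- 1 / e \<le> \<xi> < 0\<close>.\<close>
definition lambert_Wm1 :: "real \<Rightarrow> real" where
  "lambert_Wm1 \<xi> = (THE w. w \<le> -1 \<and> w * exp w = \<xi>)"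

text \<open>Meaningful only for \<open>p \<noteq> 0\<close>, because of the divisions by \<open>p\<close>.\<close>
definition rtuomg_quantile_formula :: "real \<Rightarrow> real \<Rightarrow> real \<Rightarrow> real \<Rightarrow> real" where
  "rtuomg_quantile_formula \<alpha> \<beta> p u =
     (let E = exp ((-1 / \<alpha>) * (lambert_Wm1 ((u - 1) / (p * exp (1 / p))) + 1 / p))
      in ((E - 1) / (E + 1)) powr (1 / \<beta>))"

end

theory Submission
  imports Defs "HOL-Real_Asymp.Real_Asymp"
begin

text \<open>
  The change of variable \<open>t = - ln (omega1 \<alpha> \<beta> x)\<close> maps \<open>(0,1)\<close> increasingly onto
  \<open>(0,\<infinity>)\<close> and turns the survival function \<open>1 - F\<close> into \<open>(1 + p * t) * exp (- t)\<close>, in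
  which \<open>\<alpha>\<close> and \<open>\<beta>\<close> no longer occur. For \<open>0 \<le> p \<le> 1\<close> this expression decreases strictly
  from 1 to 0 on \<open>[0,\<infinity>)\<close>, so \<open>F x = u\<close> has exactly one solution in \<open>(0,1)\<close>; outside
  \<open>(0,1)\<close> the distribution function only takes the values 0 and 1.

  To solve for \<open>t\<close> when \<open>p > 0\<close>, put \<open>w = - (t + 1 / p)\<close>. Then
  \<open>(1 + p * t) * exp (- t) = 1 - u\<close> says that \<open>w * exp w = (u - 1) / (p * exp (1 / p))\<close>, and
  \<open>w \<le> - 1\<close> because \<open>1 / p \<ge> 1\<close>: this is what selects the branch \<open>W\<^sub>-\<^sub>1\<close>. Hence
  \<open>W\<^sub>-\<^sub>1(\<dots>) + 1 / p = - t\<close>, and undoing the change of variable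
  (\<open>cdf_eq_iff_survival_exponent\<close>, \<open>rtuomg_quantile_formula_eq\<close>) gives the formula.

  At \<open>p = 0\<close> the formula is read as a limit. The survival equation with parameter \<open>q\<close> reads
  \<open>t = - ln (1 - u) + ln (1 + q * t)\<close>. Its solution stays below the one for \<open>q = 1\<close>, so the
  correction is \<open>O(q)\<close> and \<open>t\<close> tends to the exponential quantile \<open>- ln (1 - u)\<close>.
\<close>

section \<open>The survival function in the exponential variable\<close>

definition transmuted_exp_survival :: "real \<Rightarrow> real \<Rightarrow> real" where
  "transmuted_exp_survival p t = (1 + p * t) * exp (- t)"

text \<open>
  Increasing \<open>t\<close> by \<open>d > 0\<close> multiplies the linear factor by at most \<open>1 + d\<close>, since
  \<open>p \<le> 1 \<le> 1 + p * t\<close>, and divides by \<open>exp d > 1 + d\<close>. Unlike a sign argument on the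
  derivative, this covers the end point \<open>t = 0\<close> for \<open>p = 1\<close>, where the derivative vanishes.
\<close>
lemma transmuted_exp_survival_strict_antimono:
  assumes "0 \<le> p" "p \<le> 1" "0 \<le> s" "s < t"
  shows "transmuted_exp_survival p t < transmuted_exp_survival p s"
proof -
  define d where "d = t - s"
  have d: "0 < d" "t = s + d" using assms by (auto simp: d_def)
  have "1 + d + d\<^sup>2 / 2 \<le> exp d" using d by (intro exp_lower_Taylor_quadratic) auto
  moreover have "d\<^sup>2 / 2 > 0" using d by simp
  ultimately have e: "1 + d < exp d" by linarith
  have ps: "0 \<le> p * s" using assms by simp
  then have "p \<le> 1 + p * s" using assms by linarith
  then have "p * d \<le> (1 + p * s) * d" using d by (intro mult_right_mono) auto
  then have "1 + p * t \<le> (1 + p * s) * (1 + d)" by (simp add: d algebra_simps)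
  also have "\<dots> < (1 + p * s) * exp d" using e ps by (intro mult_strict_left_mono) auto
  finally have "(1 + p * t) * exp (- t) < ((1 + p * s) * exp d) * exp (- t)"
    by (intro mult_strict_right_mono) auto
  also have "\<dots> = (1 + p * s) * exp (- s)" by (simp add: d flip: exp_add)
  finally show ?thesis by (simp add: transmuted_exp_survival_def)
qed

lemma transmuted_exp_survival_inj:
  assumes "0 \<le> p" "p \<le> 1" "0 \<le> s" "0 \<le> t"
    and "transmuted_exp_survival p s = transmuted_exp_survival p t"
  shows "s = t"
  using transmuted_exp_survival_strict_antimono[OF assms(1,2), of s t]
    transmuted_exp_survival_strict_antimono[OF assms(1,2), of t s] assms
  by (cases s t rule: linorder_cases) auto

lemma transmuted_exp_survival_surj:
  assumes "0 \<le> p" "0 < v" "v < 1"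
  shows "\<exists>t>0. transmuted_exp_survival p t = v"
proof -
  have "((\<lambda>t. (1 + p * t) * exp (- t)) \<longlongrightarrow> 0) at_top" by real_asymp
  then have "eventually (\<lambda>t. transmuted_exp_survival p t < v) at_top"
    using assms by (auto simp: transmuted_exp_survival_def dest: order_tendstoD)
  then have "eventually (\<lambda>t. transmuted_exp_survival p t < v \<and> 0 \<le> t) at_top"
    by (intro eventually_conj eventually_ge_at_top)
  then obtain b where b: "transmuted_exp_survival p b < v" "0 \<le> b"
    by (auto dest: eventually_happens)
  have "\<exists>t\<ge>0. t \<le> b \<and> transmuted_exp_survival p t = v"
    using b assms
    by (intro IVT2') (auto simp: transmuted_exp_survival_def intro!: continuous_intros)
  then obtain t where t: "t \<ge> 0" "transmuted_exp_survival p t = v" by auto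
  moreover have "t \<noteq> 0" using t assms by (auto simp: transmuted_exp_survival_def)
  ultimately show ?thesis by (intro exI[of _ t]) auto
qed

section \<open>The Lambert branch\<close>

text \<open>
  Up to the factor \<open>- exp (- 1)\<close>, the map \<open>w \<mapsto> w * exp w\<close> on \<open>(-\<infinity>, -1]\<close> is the survival
  function with \<open>p = 1\<close> in the variable \<open>- 1 - w\<close>, so it is injective there.
\<close>
lemma lambert_Wm1_eqI:
  assumes "w \<le> -1" "w * exp w = \<xi>"
  shows "lambert_Wm1 \<xi> = w"
  unfolding lambert_Wm1_def
proof (rule the_equality)
  fix v assume v: "v \<le> -1 \<and> v * exp v = \<xi>"
  then have eq: "v * exp v = w * exp w" using assms by simp
  have *: "transmuted_exp_survival 1 (- 1 - z) = - exp 1 * (z * exp z)" for z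
    by (simp add: transmuted_exp_survival_def exp_add)
  have "transmuted_exp_survival 1 (- 1 - v) = transmuted_exp_survival 1 (- 1 - w)"
    unfolding * eq ..
  then have "- 1 - v = - 1 - w"
    by (rule transmuted_exp_survival_inj[rotated 4]) (use v assms in simp_all)
  then show "v = w" by simp
qed (simp add: assms)

text \<open>
  The hypothesis \<open>p \<le> 1\<close> puts \<open>- (t + 1 / p)\<close> on the branch \<open>W\<^sub>-\<^sub>1\<close> rather than on the
  principal branch.
\<close>
lemma lambert_Wm1_survival:
  assumes "0 < p" "p \<le> 1" "0 \<le> t"
  shows "lambert_Wm1 (- transmuted_exp_survival p t / (p * exp (1 / p))) = - (t + 1 / p)"
proof (rule lambert_Wm1_eqI)
  have "1 \<le> 1 / p" using assms by simp
  then show "- (t + 1 / p) \<le> -1" using assms by linarith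
  have "exp (- (t + 1 / p)) = exp (- t) / exp (1 / p)" by (simp flip: exp_diff)
  then show "- (t + 1 / p) * exp (- (t + 1 / p)) =
      - transmuted_exp_survival p t / (p * exp (1 / p))"
    using assms by (simp add: transmuted_exp_survival_def field_simps)
qed

section \<open>Undoing the change of variable\<close>

text \<open>
  The map from \<open>(0,\<infinity>)\<close> to \<open>(0,1)\<close> inverse to \<open>x \<mapsto> - ln (omega1 \<alpha> \<beta> x)\<close>.
\<close>
definition omega_of_exp :: "real \<Rightarrow> real \<Rightarrow> real \<Rightarrow> real" where
  "omega_of_exp \<alpha> \<beta> t = ((exp (t / \<alpha>) - 1) / (exp (t / \<alpha>) + 1)) powr (1 / \<beta>)"

lemma omega_of_exp_in_unit:
  assumes "0 < \<alpha>" "0 < \<beta>" "0 < t"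
  shows "0 < omega_of_exp \<alpha> \<beta> t" "omega_of_exp \<alpha> \<beta> t < 1"
proof -
  define E where "E = exp (t / \<alpha>)"
  have E: "1 < E" using assms by (simp add: E_def)
  then have y: "0 < (E - 1) / (E + 1)" "(E - 1) / (E + 1) < 1" by (auto simp: field_simps)
  show "0 < omega_of_exp \<alpha> \<beta> t" using y unfolding omega_of_exp_def E_def by (subst powr_gt_zero) auto
  have "((E - 1) / (E + 1)) powr (1 / \<beta>) < 1 powr (1 / \<beta>)"
    using y assms by (intro powr_less_mono2) auto
  then show "omega_of_exp \<alpha> \<beta> t < 1" by (simp add: omega_of_exp_def E_def)
qed

lemma omega1_omega_of_exp:
  assumes "0 < \<alpha>" "0 < \<beta>" "0 < t"
  shows "omega1 \<alpha> \<beta> (omega_of_exp \<alpha> \<beta> t) = exp (- t)"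
proof -
  define E where "E = exp (t / \<alpha>)"
  have E: "1 < E" using assms by (simp add: E_def)
  define y where "y = (E - 1) / (E + 1)"
  have "0 < y" using E by (simp add: y_def)
  then have "omega_of_exp \<alpha> \<beta> t powr \<beta> = y"
    using assms by (simp add: omega_of_exp_def E_def y_def powr_powr)
  moreover have "(1 + y) / (1 - y) = E" using E by (simp add: y_def field_simps)
  ultimately have "omega1 \<alpha> \<beta> (omega_of_exp \<alpha> \<beta> t) = E powr (- \<alpha>)"
    by (simp add: omega1_def)
  also have "\<dots> = exp (- t)" using assms by (simp add: E_def powr_def)
  finally show ?thesis .
qed

lemma omega_of_exp_surj:
  assumes "0 < \<alpha>" "0 < \<beta>" "0 < x" "x < 1"
  obtains t where "0 < t" "omega_of_exp \<alpha> \<beta> t = x"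
proof
  define y where "y = x powr \<beta>"
  have y: "0 < y" "y < 1"
    using assms powr_less_mono2[of \<beta> x 1] by (auto simp: y_def)
  define t where "t = \<alpha> * ln ((1 + y) / (1 - y))"
  have r: "1 < (1 + y) / (1 - y)" using y by (simp add: field_simps)
  then show "0 < t" using assms by (simp add: t_def)
  have "exp (t / \<alpha>) = (1 + y) / (1 - y)" using r assms by (simp add: t_def)
  moreover have "((1 + y) / (1 - y) - 1) / ((1 + y) / (1 - y) + 1) = y"
    using y by (simp add: field_simps)
  ultimately show "omega_of_exp \<alpha> \<beta> t = x"
    using assms by (simp add: omega_of_exp_def y_def powr_powr)
qed

lemma rtuomg_cdf_omega_of_exp:
  assumes "0 < \<alpha>" "0 < \<beta>" "0 < t"
  shows "rtuomg_cdf \<alpha> \<beta> p (omega_of_exp \<alpha> \<beta> t) = 1 - transmuted_exp_survival p t"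
  by (simp add: rtuomg_cdf_def omega1_omega_of_exp[OF assms] transmuted_exp_survival_def
      algebra_simps)

lemma rtuomg_quantile_formula_eq:
  assumes "0 < p" "p \<le> 1" "0 \<le> t" "transmuted_exp_survival p t = 1 - u"
  shows "rtuomg_quantile_formula \<alpha> \<beta> p u = omega_of_exp \<alpha> \<beta> t"
  using lambert_Wm1_survival[OF assms(1-3)] assms(4)
  by (simp add: rtuomg_quantile_formula_def omega_of_exp_def Let_def)

section \<open>The quantile of the distribution\<close>

lemma cdf_outside_unit_interval:
  assumes "prob_space M" and dist: "has_rtuomg_distribution M X \<alpha> \<beta> p"
  shows "x \<le> 0 \<Longrightarrow> cdf (distr M borel X) x = 0"
    and "1 \<le> x \<Longrightarrow> cdf (distr M borel X) x = 1"
proof -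
  interpret prob_space M by fact
  have [measurable]: "X \<in> borel_measurable M" and ae: "AE \<omega> in M. 0 < X \<omega> \<and> X \<omega> < 1"
    using dist by (auto simp: has_rtuomg_distribution_def)
  have c: "cdf (distr M borel X) x = \<P>(\<omega> in M. X \<omega> \<le> x)"
    by (auto simp: cdf_def measure_distr intro!: arg_cong[where f = prob])
  show "cdf (distr M borel X) x = 0" if "x \<le> 0"
    unfolding c using ae that by (intro prob_eq_0_AE) auto
  show "cdf (distr M borel X) x = 1" if "1 \<le> x"
    unfolding c using ae that by (subst prob_Collect_eq_1) auto
qed

text \<open>
  Every solution of \<open>F x = u\<close> lies in \<open>(0,1)\<close> because \<open>u\<close> is neither 0 nor 1; there
  the equation becomes the survival equation.
\<close>
lemma cdf_eq_iff_survival_exponent: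
  assumes "prob_space M" and ab: "0 < \<alpha>" "0 < \<beta>" and p: "0 \<le> p" "p \<le> 1"
    and dist: "has_rtuomg_distribution M X \<alpha> \<beta> p"
    and u: "0 < u" "u < 1" and t: "0 < t" "transmuted_exp_survival p t = 1 - u"
  shows "cdf (distr M borel X) x = u \<longleftrightarrow> x = omega_of_exp \<alpha> \<beta> t"
proof -
  have F: "cdf (distr M borel X) (omega_of_exp \<alpha> \<beta> s) = 1 - transmuted_exp_survival p s"
    if "0 < s" for s
    using dist omega_of_exp_in_unit[OF ab that] rtuomg_cdf_omega_of_exp[OF ab that]
    by (auto simp: has_rtuomg_distribution_def)
  show ?thesis
  proof
    assume x: "cdf (distr M borel X) x = u"
    then have "0 < x" "x < 1"
      using cdf_outside_unit_interval[OF assms(1) dist, of x] u by (force simp: not_le[symmetric])+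
    then obtain s where s: "0 < s" "omega_of_exp \<alpha> \<beta> s = x"
      using omega_of_exp_surj[OF ab] by metis
    have "transmuted_exp_survival p s = transmuted_exp_survival p t"
      using F[OF s(1)] s x t by simp
    then have "s = t" using transmuted_exp_survival_inj[OF p, of s t] s t by simp
    then show "x = omega_of_exp \<alpha> \<beta> t" using s by simp
  qed (use F[OF t(1)] t in simp)
qed

text \<open>
  The solution \<open>t\<close> of the survival equation is squeezed: \<open>exp (- t) \<le> 1 - u\<close> bounds it below
  by the exponential quantile, and \<open>ln (1 + q * t) \<le> q * t\<close> bounds the excess, where \<open>t\<close> is at
  most the solution \<open>T\<close> for \<open>q = 1\<close> since the survival function increases with the parameter.
\<close>
lemma rtuomg_quantile_formula_tendsto:
  assumes "0 < \<alpha>" "0 < \<beta>" "0 < u" "u < 1"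
  shows "((\<lambda>q. rtuomg_quantile_formula \<alpha> \<beta> q u) \<longlongrightarrow> omega_of_exp \<alpha> \<beta> (- ln (1 - u)))
           (at_right 0)"
proof -
  define t0 where "t0 = - ln (1 - u)"
  have t0: "0 < t0" using assms by (simp add: t0_def)
  obtain T where T: "0 < T" "transmuted_exp_survival 1 T = 1 - u"
    using transmuted_exp_survival_surj[of 1 "1 - u"] assms by auto
  define t where "t q = (SOME s. 0 < s \<and> transmuted_exp_survival q s = 1 - u)" for q
  have t: "0 < t q" "transmuted_exp_survival q (t q) = 1 - u" if "0 < q" for q
    using someI_ex[of "\<lambda>s. 0 < s \<and> transmuted_exp_survival q s = 1 - u"]
      transmuted_exp_survival_surj[of q "1 - u"] assms that by (auto simp: t_def)
  have bounds: "t0 \<le> t q \<and> t q \<le> t0 + q * T" if q: "0 < q" "q < 1" for q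
  proof -
    have le: "t q \<le> T"
    proof (rule ccontr)
      assume "\<not> t q \<le> T"
      then have "transmuted_exp_survival q (t q) < transmuted_exp_survival q T"
        using q T by (intro transmuted_exp_survival_strict_antimono) auto
      also have "\<dots> \<le> transmuted_exp_survival 1 T"
        unfolding transmuted_exp_survival_def using q T by (intro mult_right_mono) auto
      finally show False using t[OF q(1)] T by simp
    qed
    have pos: "0 < q * t q" using q t by simp
    have "ln ((1 + q * t q) * exp (- t q)) = ln (1 - u)"
      using t[OF q(1)] by (simp add: transmuted_exp_survival_def)
    then have "ln (1 + q * t q) - t q = - t0"
      using pos by (subst (asm) ln_mult) (auto simp: t0_def)
    moreover have "0 \<le> ln (1 + q * t q)" using pos by simp
    moreover have "ln (1 + q * t q) \<le> q * t q" using pos by (intro ln_add_one_self_le_self) auto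
    moreover have "q * t q \<le> q * T" using le q by simp
    ultimately show ?thesis by linarith
  qed
  have near: "eventually (\<lambda>q. 0 < q \<and> q < 1) (at_right (0::real))"
    using eventually_at_right_real[of 0 "1::real"] by simp
  have "((\<lambda>q. t0 + q * T) \<longlongrightarrow> t0 + 0 * T) (at_right 0)"
    by (intro tendsto_intros)
  then have upper: "((\<lambda>q. t0 + q * T) \<longlongrightarrow> t0) (at_right 0)" by simp
  have "(t \<longlongrightarrow> t0) (at_right 0)"
  proof (rule tendsto_sandwich[OF _ _ tendsto_const upper])
    show "eventually (\<lambda>q. t0 \<le> t q) (at_right 0)"
      using near by eventually_elim (use bounds in blast)
    show "eventually (\<lambda>q. t q \<le> t0 + q * T) (at_right 0)"
      using near by eventually_elim (use bounds in blast)
  qed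
  moreover have "isCont (omega_of_exp \<alpha> \<beta>) t0"
  proof -
    have E: "1 < exp (t0 / \<alpha>)" using t0 assms by simp
    then have den: "exp (t0 / \<alpha>) + 1 \<noteq> 0" and "exp (t0 / \<alpha>) - 1 \<noteq> 0"
      by linarith+
    then have "(exp (t0 / \<alpha>) - 1) / (exp (t0 / \<alpha>) + 1) \<noteq> 0"
      by (simp only: divide_eq_0_iff) simp
    with den show ?thesis
      unfolding omega_of_exp_def using assms by (intro continuous_intros) auto
  qed
  ultimately have "((\<lambda>q. omega_of_exp \<alpha> \<beta> (t q)) \<longlongrightarrow> omega_of_exp \<alpha> \<beta> t0) (at_right 0)"
    by (rule isCont_tendsto_compose[rotated])
  then show ?thesis
    unfolding t0_def
  proof (rule Lim_transform_eventually)
    show "eventually (\<lambda>q. omega_of_exp \<alpha> \<beta> (t q) = rtuomg_quantile_formula \<alpha> \<beta> q u) (at_right 0)"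
      using near
    proof eventually_elim
      case (elim q)
      then show ?case using rtuomg_quantile_formula_eq[of q "t q" u \<alpha> \<beta>] t[of q] by simp
    qed
  qed
qed

theorem theorem2p1:
  fixes M :: "'a measure" and X :: "'a \<Rightarrow> real" and \<alpha> \<beta> p :: real
  assumes "prob_space M"
    and "\<alpha> > 0" and "\<beta> > 0" and "0 \<le> p" and "p \<le> 1"
    and "has_rtuomg_distribution M X \<alpha> \<beta> p"
  shows "\<forall>u::real. 0 < u \<and> u < 1 \<longrightarrow>
           (\<exists>!x. cdf (distr M borel X) x = u) \<and>
           (p \<noteq> 0 \<longrightarrow> quantile (distr M borel X) u = rtuomg_quantile_formula \<alpha> \<beta> p u) \<and>
           (p = 0 \<longrightarrow> ((\<lambda>q. rtuomg_quantile_formula \<alpha> \<beta> q u)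
                         \<longlongrightarrow> quantile (distr M borel X) u) (at_right 0))"
proof (intro allI impI)
  fix u :: real assume "0 < u \<and> u < 1"
  then have u: "0 < u" "u < 1" by auto
  obtain t where t: "0 < t" "transmuted_exp_survival p t = 1 - u"
    using transmuted_exp_survival_surj[of p "1 - u"] assms u by auto
  note solution = cdf_eq_iff_survival_exponent[OF assms u t]
  have Q: "quantile (distr M borel X) u = omega_of_exp \<alpha> \<beta> t"
    by (simp add: quantile_def solution)
  have "\<exists>!x. cdf (distr M borel X) x = u" by (simp add: solution)
  moreover have "quantile (distr M borel X) u = rtuomg_quantile_formula \<alpha> \<beta> p u" if "p \<noteq> 0"
    using rtuomg_quantile_formula_eq[of p t u \<alpha> \<beta>] assms t that Q by simp
  moreover have "((\<lambda>q. rtuomg_quantile_formula \<alpha> \<beta> q u)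
      \<longlongrightarrow> quantile (distr M borel X) u) (at_right 0)" if "p = 0"
  proof -
    have "exp (- t) = 1 - u" using t that by (simp add: transmuted_exp_survival_def)
    then have "t = - ln (1 - u)" by (metis ln_exp minus_minus)
    then show ?thesis using rtuomg_quantile_formula_tendsto[of \<alpha> \<beta> u] assms u Q by simp
  qed
  ultimately show "(\<exists>!x. cdf (distr M borel X) x = u) \<and>
      (p \<noteq> 0 \<longrightarrow> quantile (distr M borel X) u = rtuomg_quantile_formula \<alpha> \<beta> p u) \<and>
      (p = 0 \<longrightarrow> ((\<lambda>q. rtuomg_quantile_formula \<alpha> \<beta> q u)
                    \<longlongrightarrow> quantile (distr M borel X) u) (at_right 0))" by blast
qed

end
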